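(* Let $\lambda,\mu,\nu,\alpha,\beta$ be real numbers with $\lambda,\mu,\nu>0$, $\alpha>\beta>0$ and $\rho:=\lambda/\mu<1$. For non-negative integers $Q,L$ define the anticipated costs $$C(a=1)=\alpha\frac{Q}{\mu},\qquad C(a=2)=\frac{\beta}{\nu}+\frac{\alpha}{\mu}\left(Q+L-\frac{\mu-\lambda}{\nu}\right)^+ ,$$ and let the optimal decision $a^*=a^*(Q,L)\in\{1,2\}$ be $2$ if $C(a=1)>C(a=2)$ and $1$ otherwise. Set $$A=\frac{\mu\beta}{\alpha\nu},\qquad B=\frac{\mu-\lambda}{\nu}-A .$$ Then for all non-negative integers $Q,L$, $$a^*(Q,L)=\begin{cases}2,&\text{if } Q>A \text{ and } L<B,\\ 1,&\text{otherwise.}\end{cases}$$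
   Context: Model: single-server queue with a lounge; Poisson arrivals of rate $\lambda$, exponential service times of rate $\mu$, exponential lounge stays of rate $\nu$; waiting costs $\alpha$ per unit time in the queue and $\beta$ per unit time in the lounge. An arriving customer observes the queue length $Q$ and the lounge size $L$, and chooses $a=1$ (join the queue directly) or $a=2$ (first go to the lounge, then join the queue). The customer chooses the lounge if and only if $C(a=1)>C(a=2)$ (ties are broken in favour of $a=1$). Here $x^+=\max\{x,0\}$. *)

theory Defs
  imports Complex_Main
begin

definition pos_part :: "real \<Rightarrow> real" where
  "pos_part x = max x 0"

definition cost_direct :: "real \<Rightarrow> real \<Rightarrow> nat \<Rightarrow> real" where
  "cost_direct \<mu> \<alpha> Q = \<alpha> * (real Q / \<mu>)"

definition cost_lounge ::
  "real \<Rightarrow> real \<Rightarrow> real \<Rightarrow> real \<Rightarrow> real \<Rightarrow> nat \<Rightarrow> nat \<Rightarrow> real" where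
  "cost_lounge lam \<mu> \<nu> \<alpha> \<beta> Q L =
     \<beta> / \<nu> + \<alpha> / \<mu> * pos_part (real Q + real L - (\<mu> - lam) / \<nu>)"

(* The decision is 1 (join the queue directly) or 2 (first go to the lounge). *)
definition opt_decision ::
  "real \<Rightarrow> real \<Rightarrow> real \<Rightarrow> real \<Rightarrow> real \<Rightarrow> nat \<Rightarrow> nat \<Rightarrow> nat" where
  "opt_decision lam \<mu> \<nu> \<alpha> \<beta> Q L =
     (if cost_direct \<mu> \<alpha> Q > cost_lounge lam \<mu> \<nu> \<alpha> \<beta> Q L then 2 else 1)"

end

theory Submission
  imports Defs
begin

text \<open>Measured in units of \<alpha> / \<mu>, the mean cost of one service ahead in the queue,
  joining directly costs Q and the lounge costs A plus the positive part of Q + L - (\<mu> - lam) /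
  \<nu>. Exceeding A plus a maximum means exceeding A plus each of its two terms: the term 0 gives Q
  > A, and in the other Q cancels, leaving a threshold on L alone.\<close>

theorem theorem1:
  fixes lam \<mu> \<nu> \<alpha> \<beta> \<rho> A B :: real
  assumes "lam > 0" and "\<mu> > 0" and "\<nu> > 0"
    and "\<alpha> > \<beta>" and "\<beta> > 0"
    and "\<rho> = lam / \<mu>" and "\<rho> < 1"
    and "A = \<mu> * \<beta> / (\<alpha> * \<nu>)"
    and "B = (\<mu> - lam) / \<nu> - A"
  shows "\<forall>Q L :: nat. opt_decision lam \<mu> \<nu> \<alpha> \<beta> Q L =
           (if real Q > A \<and> real L < B then 2 else 1)"
proof (intro allI)
  fix Q L :: nat
  define c where "c = \<alpha> / \<mu>"
  define d where "d = (\<mu> - lam) / \<nu>"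
  \<comment> \<open>\<open>A\<close> is the expected cost of the lounge stay in units of
    \<open>c\<close>; \<alpha> > \<beta> > 0 makes \<alpha> positive, so it cancels.\<close>
  have "c > 0" and "\<beta> / \<nu> = c * A"
    using assms by (simp_all add: c_def)
  have "cost_lounge lam \<mu> \<nu> \<alpha> \<beta> Q L = c * (A + pos_part (real Q + real L - d))"
    unfolding cost_lounge_def c_def [symmetric] d_def [symmetric] \<open>\<beta> / \<nu> = c * A\<close>
    by (simp add: distrib_left)
  moreover have "cost_direct \<mu> \<alpha> Q = c * real Q"
    by (simp add: cost_direct_def c_def)
  ultimately have "cost_direct \<mu> \<alpha> Q > cost_lounge lam \<mu> \<nu> \<alpha> \<beta> Q L \<longleftrightarrow>
      real Q > A + pos_part (real Q + real L - d)"
    using \<open>c > 0\<close> by simp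
  \<comment> \<open>Against the nonzero branch of the maximum, the condition is L < d -
    \<open>A\<close>, and d - \<open>A\<close> is \<open>B\<close>.\<close>
  also have "\<dots> \<longleftrightarrow> real Q > A \<and> real L < B"
    using assms(9) by (auto simp: pos_part_def d_def [symmetric])
  finally show "opt_decision lam \<mu> \<nu> \<alpha> \<beta> Q L =
      (if real Q > A \<and> real L < B then 2 else 1)"
    by (simp add: opt_decision_def)
qed

end
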